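(* Let $m=pq$ where $p$ and $q$ are different odd primes, and let $n$ be a positive integer. Then the graph $G=C_m\odot\overline{K}_n$ is perfect edge-magic.
   Context: For graphs $G,H$, the corona product $G\odot H$ is obtained from one copy of $G$ and $|V(G)|$ copies of $H$ by joining each vertex of $G$ to all vertices of one copy of $H$, in such a way that all vertices in the same copy of $H$ are joined to exactly one vertex of $G$. $C_m$ is the cycle of order $m$ and $\overline{K}_n$ is the graph with $n$ vertices and no edges; so $C_m\odot\overline{K}_n$ is the cycle $C_m$ with $n$ pendant vertices attached to each cycle vertex. Let $G=(V,E)$ be a graph with $P=|V|$ vertices and $Q=|E|$ edges. An edge-magic labeling of $G$ is a bijection $f:V\cup E\to\{1,\dots,P+Q\}$ such that $f(x)+f(xy)+f(y)=k$ for every edge $xy\in E$, where $k$ is a constant called the valence of $f$. Let $T_G$ be the set of all numbers $\frac1Q\left(\sum_{u\in V}\deg(u)g(u)+\sum_{e\in E}g(e)\right)$, where $g$ ranges over all bijections $V\cup E\to\{1,\dots,P+Q\}$. If $\lceil\min T_G\rceil\le\lfloor\max T_G\rfloor$, the magic interval of $G$ is $J_G=[\lceil\min T_G\rceil,\lfloor\max T_G\rfloor]\cap\mathbb{Z}$, and the magic set $\tau_G$ is the set of all $k\in J_G$ such that $k$ is the valence of some edge-magic labeling of $G$. $G$ is called perfect edge-magic if $\tau_G=J_G$. *)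

theory Defs
  imports Complex_Main "HOL-Computational_Algebra.Primes"
begin

record 'a ugraph =
  verts :: "'a set"
  edges :: "'a set set"

definition simple_graph :: "('a, 'z) ugraph_scheme \<Rightarrow> bool" where
  "simple_graph G \<longleftrightarrow> finite (verts G) \<and> (\<forall>e \<in> edges G. e \<subseteq> verts G \<and> card e = 2)"

definition degree :: "('a, 'z) ugraph_scheme \<Rightarrow> 'a \<Rightarrow> nat" where
  "degree G u = card {e \<in> edges G. u \<in> e}"

text \<open>A cycle in the usual sense only for \<open>m \<ge> 3\<close>.\<close>

definition cycle_graph :: "nat \<Rightarrow> nat ugraph" where
  "cycle_graph m = \<lparr>verts = {..<m}, edges = (\<lambda>i. {i, Suc i mod m}) ` {..<m}\<rparr>"

definition edgeless_graph :: "nat \<Rightarrow> nat ugraph" where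
  "edgeless_graph n = \<lparr>verts = {..<n}, edges = {}\<rparr>"

text \<open>The vertex \<open>v\<close> of \<open>G\<close> is \<open>Inl v\<close>, and \<open>Inr (v, x)\<close> is the vertex \<open>x\<close> in the copy of \<open>H\<close>
  belonging to \<open>v\<close>.\<close>

definition corona :: "'a ugraph \<Rightarrow> 'b ugraph \<Rightarrow> ('a + 'a \<times> 'b) ugraph" (infixl \<open>\<odot>\<close> 70) where
  "G \<odot> H =
    \<lparr>verts = verts G <+> verts G \<times> verts H,
     edges = (\<lambda>e. Inl ` e) ` edges G
           \<union> (\<lambda>(v, e). (\<lambda>x. Inr (v, x)) ` e) ` (verts G \<times> edges H)
           \<union> (\<lambda>(v, x). {Inl v, Inr (v, x)}) ` (verts G \<times> verts H)\<rparr>"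

text \<open>Labelings live on the disjoint union of vertices (\<open>Inl\<close>) and edges (\<open>Inr\<close>).\<close>

definition total_labeling :: "('a, 'z) ugraph_scheme \<Rightarrow> ('a + 'a set \<Rightarrow> nat) \<Rightarrow> bool" where
  "total_labeling G f \<longleftrightarrow>
    bij_betw f (verts G <+> edges G) {1..card (verts G) + card (edges G)}"

definition edge_magic_labeling ::
    "('a, 'z) ugraph_scheme \<Rightarrow> ('a + 'a set \<Rightarrow> nat) \<Rightarrow> nat \<Rightarrow> bool" where
  "edge_magic_labeling G f k \<longleftrightarrow> total_labeling G f \<and>
    (\<forall>x y. {x, y} \<in> edges G \<longrightarrow> f (Inl x) + f (Inr {x, y}) + f (Inl y) = k)"

definition magic_averages :: "('a, 'z) ugraph_scheme \<Rightarrow> real set" where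
  "magic_averages G =
    {((\<Sum>u \<in> verts G. real (degree G u) * real (g (Inl u))) + (\<Sum>e \<in> edges G. real (g (Inr e))))
       / real (card (edges G)) | g. total_labeling G g}"

definition magic_interval :: "('a, 'z) ugraph_scheme \<Rightarrow> int set" where
  "magic_interval G = {\<lceil>Min (magic_averages G)\<rceil>..\<lfloor>Max (magic_averages G)\<rfloor>}"

definition magic_set :: "('a, 'z) ugraph_scheme \<Rightarrow> int set" where
  "magic_set G = {k \<in> magic_interval G. \<exists>f v. edge_magic_labeling G f v \<and> k = int v}"

text \<open>The magic interval is defined mathematically only if its lower bound does not exceed its
  upper bound; the first conjunct excludes graphs without a magic interval.\<close>

definition perfect_edge_magic :: "('a, 'z) ugraph_scheme \<Rightarrow> bool" where
  "perfect_edge_magic G \<longleftrightarrow>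
    \<lceil>Min (magic_averages G)\<rceil> \<le> \<lfloor>Max (magic_averages G)\<rfloor> \<and> magic_set G = magic_interval G"

lemma simple_graph_cycle:
  assumes "3 \<le> m"
  shows "simple_graph (cycle_graph m)"
proof -
  have "i \<noteq> Suc i mod m" if "i < m" for i
    using assms that by (cases "Suc i = m") auto
  with assms show ?thesis
    by (auto simp: simple_graph_def cycle_graph_def card_2_iff)
qed

lemma simple_graph_edgeless: "simple_graph (edgeless_graph n)"
  by (simp add: simple_graph_def edgeless_graph_def)

lemma simple_graph_corona:
  assumes "simple_graph G" "simple_graph H"
  shows "simple_graph (G \<odot> H)"
  using assms
  by (auto simp: simple_graph_def corona_def card_image inj_on_def subset_iff)

end

theory Submission
  imports Defs
begin

text \<open>The theorem is the case \<open>m = p * q\<close> of the same assertion for every odd \<open>m \<ge> 3\<close>. Write \<open>m = 2 * h + 1\<close> and \<open>M = m * (n + 1)\<close>. The crown has \<open>M\<close> vertices and \<open>M\<close>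
  edges. Every vertex lies on one edge, except that a cycle vertex lies on \<open>n + 2\<close>. So the sum of all
  edge weights is \<open>M * (2 * M + 1)\<close>, the sum of all labels, plus \<open>n + 1\<close> times the sum of the
  labels on the cycle. That last sum is least when the cycle carries \<open>1, \<dots>, m\<close> and greatest when it
  carries the \<open>m\<close> largest labels, so the averages lie between \<open>2 * M + h + 2\<close> and
  \<open>4 * M + 1 - h\<close>. Since a valence is itself an average, it suffices to realise every integer in
  this range as a valence: the two extreme ones then show that the bounds are the minimum and the
  maximum (\<open>perfect_edge_magicI\<close>).

  Labelings come from numberings of the vertices by \<open>0, \<dots>, M - 1\<close> whose edge sums are the
  consecutive numbers \<open>w, \<dots>, w + M - 1\<close>. Giving the edges their sums in reverse order makes
  all edge weights equal. There are four ways to share \<open>1, \<dots>, 2 * M\<close> between vertices and edges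
  (lower or upper half, odd or even numbers), and they turn one such numbering into valences
  \<open>2 * M + w + 2\<close>, \<open>3 * M + w + 2\<close>, \<open>2 * M + 2 * w + 2\<close> and \<open>2 * M + 2 * w + 3\<close>
  (\<open>edge_magic_labelings_of_consecutive_edge_sums\<close>). If \<open>w\<close> can be any number from \<open>h\<close> to
  \<open>h + m * n\<close>, the first two cover the lower and the upper part of the range, and the last two
  cover the gap between them.

  It remains to build a numbering for each such \<open>w\<close>
  (\<open>consecutive_edge_sums_crown\<close>). Number the cycle alone by \<open>0, \<dots>, m - 1\<close>
  so that the edge leaving \<open>j\<close> has sum \<open>j + h\<close>. Use these values \<open>b j\<close> as residues modulo \<open>m\<close>:
  the cycle vertex \<open>j\<close> gets the label \<open>b j + m * s j\<close>, with a level \<open>s j \<le> n\<close> still to be chosen,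
  and the \<open>n\<close> remaining labels in the residue class of the successor of \<open>j\<close> go to the pendant
  vertices at \<open>j\<close>. Then \<open>j\<close> is joined, by its pendant edges and the cycle edge leaving it, to exactly
  one vertex for each level \<open>t \<le> n\<close> of that class, and the sums of these edges are
  \<open>h + (j + m * s j) + m * t\<close>. All edge sums together are consecutive as soon as the numbers
  \<open>j + m * s j\<close> are \<open>S, \<dots>, S + m - 1\<close> in some order. This fixes the levels for every
  \<open>S \<le> m * n\<close>, and gives \<open>w = S + h\<close>.\<close>

section \<open>Valences as averages\<close>

lemma finite_edges_simple_graph:
  assumes "simple_graph G"
  shows "finite (edges G)"
proof (rule finite_subset)
  show "edges G \<subseteq> Pow (verts G)" "finite (Pow (verts G))"
    using assms by (auto simp: simple_graph_def)
qed

lemma sum_degree_times: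
  fixes c :: "'a \<Rightarrow> nat"
  assumes "simple_graph G"
  shows "(\<Sum>u\<in>verts G. degree G u * c u) = (\<Sum>e\<in>edges G. \<Sum>u\<in>e. c u)"
proof -
  have "(\<Sum>u\<in>verts G. degree G u * c u) = (\<Sum>u\<in>verts G. \<Sum>e | e \<in> edges G \<and> u \<in> e. c u)"
    by (simp add: degree_def)
  also have "\<dots> = (\<Sum>e\<in>edges G. \<Sum>u | u \<in> verts G \<and> u \<in> e. c u)"
    using assms finite_edges_simple_graph[OF assms]
    by (intro sum.swap_restrict) (simp_all add: simple_graph_def)
  also have "\<dots> = (\<Sum>e\<in>edges G. \<Sum>u\<in>e. c u)"
    using assms by (intro sum.cong refl) (auto simp: simple_graph_def)
  finally show ?thesis .
qed

definition edge_weight :: "('a + 'a set \<Rightarrow> nat) \<Rightarrow> 'a set \<Rightarrow> nat" where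
  "edge_weight g e = (\<Sum>u\<in>e. g (Inl u)) + g (Inr e)"

text \<open>Counting incidences turns the degree-weighted sum over vertices into a sum over edges, so an
  element of \<^const>\<open>magic_averages\<close> is an average edge weight. A valence is then the average of a
  constant.\<close>

lemma magic_averages_eq:
  assumes "simple_graph G"
  shows "magic_averages G =
    {real (\<Sum>e\<in>edges G. edge_weight g e) / real (card (edges G)) | g. total_labeling G g}"
proof -
  have "(\<Sum>u\<in>verts G. real (degree G u) * real (g (Inl u))) + (\<Sum>e\<in>edges G. real (g (Inr e)))
      = real (\<Sum>e\<in>edges G. edge_weight g e)" for g
    using arg_cong[where f = real, OF sum_degree_times[OF assms, of "\<lambda>u. g (Inl u)"]]
    by (simp add: edge_weight_def sum.distrib)
  then show ?thesis
    by (simp add: magic_averages_def)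
qed

lemma edge_magic_labeling_iff:
  assumes "simple_graph G"
  shows "edge_magic_labeling G f k \<longleftrightarrow>
    total_labeling G f \<and> (\<forall>e\<in>edges G. edge_weight f e = k)"
proof -
  have "(\<forall>x y. {x, y} \<in> edges G \<longrightarrow> f (Inl x) + f (Inr {x, y}) + f (Inl y) = k) \<longleftrightarrow>
    (\<forall>e\<in>edges G. edge_weight f e = k)" (is "?L \<longleftrightarrow> ?R")
  proof
    assume L: ?L
    show ?R
    proof
      fix e assume e: "e \<in> edges G"
      then have "card e = 2"
        using assms by (simp add: simple_graph_def)
      then obtain x y where xy: "e = {x, y}" "x \<noteq> y"
        by (auto simp: card_2_iff)
      with L e have "f (Inl x) + f (Inr {x, y}) + f (Inl y) = k"
        by blast
      with xy show "edge_weight f e = k"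
        by (simp add: edge_weight_def)
    qed
  next
    assume R: ?R
    show ?L
    proof (intro allI impI)
      fix x y assume e: "{x, y} \<in> edges G"
      then have "card {x, y} = 2"
        using assms by (auto simp: simple_graph_def)
      then have "x \<noteq> y" by auto
      moreover have "edge_weight f {x, y} = k"
        using R e by blast
      ultimately show "f (Inl x) + f (Inr {x, y}) + f (Inl y) = k"
        by (simp add: edge_weight_def)
    qed
  qed
  then show ?thesis by (simp add: edge_magic_labeling_def)
qed

text \<open>The valences \<open>a\<close> and \<open>b\<close> are elements of the set of averages and also bounds for it, so they are
  its extrema. The bounds also give finiteness of the set: there are only finitely many possible
  total edge weights.\<close>

lemma perfect_edge_magicI:
  fixes a b :: nat
  assumes "simple_graph G" and "edges G \<noteq> {}" and "a \<le> b"
    and bounds: "\<And>g. total_labeling G g \<Longrightarrow>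
      (\<Sum>e\<in>edges G. edge_weight g e) \<in> {a * card (edges G)..b * card (edges G)}"
    and valences: "\<And>k. k \<in> {a..b} \<Longrightarrow> \<exists>f. edge_magic_labeling G f k"
  shows "perfect_edge_magic G"
proof -
  let ?Q = "card (edges G)" and ?T = "magic_averages G"
  have Q: "?Q > 0"
    using assms finite_edges_simple_graph by (simp add: card_gt_0_iff)
  have T: "?T = {real (\<Sum>e\<in>edges G. edge_weight g e) / real ?Q | g. total_labeling G g}"
    by (rule magic_averages_eq) fact
  then have "?T \<subseteq> (\<lambda>s. real s / real ?Q) ` {a * ?Q..b * ?Q}"
    using bounds by blast
  then have fin: "finite ?T"
    by (rule finite_subset) simp
  have attained: "real k \<in> ?T" if k: "k \<in> {a..b}" for k
  proof -
    obtain f where "edge_magic_labeling G f k"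
      using valences[OF k] by blast
    then have "total_labeling G f" "(\<Sum>e\<in>edges G. edge_weight f e) = ?Q * k"
      using edge_magic_labeling_iff[OF \<open>simple_graph G\<close>] by auto
    then have "total_labeling G f" "real k = real (\<Sum>e\<in>edges G. edge_weight f e) / real ?Q"
      using Q by simp_all
    then show ?thesis unfolding T by blast
  qed
  have between: "real a \<le> x \<and> x \<le> real b" if x: "x \<in> ?T" for x
  proof -
    obtain g where g: "x = real (\<Sum>e\<in>edges G. edge_weight g e) / real ?Q" "total_labeling G g"
      using x unfolding T by blast
    have "real (a * ?Q) \<le> real (\<Sum>e\<in>edges G. edge_weight g e)"
      "real (\<Sum>e\<in>edges G. edge_weight g e) \<le> real (b * ?Q)"
      using bounds[OF g(2)] unfolding of_nat_le_iff by auto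
    then show ?thesis
      using Q unfolding g(1) by (simp add: field_simps)
  qed
  have "Min ?T = real a"
    using fin attained[of a] between \<open>a \<le> b\<close> by (intro Min_eqI) auto
  moreover have "Max ?T = real b"
    using fin attained[of b] between \<open>a \<le> b\<close> by (intro Max_eqI) auto
  ultimately have J: "magic_interval G = {int a..int b}" "\<lceil>Min ?T\<rceil> \<le> \<lfloor>Max ?T\<rfloor>"
    using \<open>a \<le> b\<close> by (simp_all add: magic_interval_def)
  have "k \<in> magic_set G" if "k \<in> magic_interval G" for k
  proof -
    from that J have "nat k \<in> {a..b}" "k = int (nat k)" by auto
    with valences show ?thesis
      using that unfolding magic_set_def by blast
  qed
  with J show ?thesis
    by (auto simp: perfect_edge_magic_def magic_set_def)
qed

section \<open>Edge-magic labelings from consecutive edge sums\<close>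

text \<open>This is a super edge-magic labeling without its edge labels and with vertex numbers starting at
  \<open>0\<close>; the shift keeps the reductions modulo the cycle length free of corrections.\<close>

definition consecutive_edge_sums :: "('a, 'z) ugraph_scheme \<Rightarrow> ('a \<Rightarrow> nat) \<Rightarrow> nat \<Rightarrow> bool" where
  "consecutive_edge_sums G l w \<longleftrightarrow>
    bij_betw l (verts G) {..<card (verts G)} \<and>
    bij_betw (\<lambda>e. \<Sum>u\<in>e. l u) (edges G) {w..<w + card (edges G)}"

lemma bij_betw_map_sum_Plus:
  assumes f: "bij_betw f A C" and g: "bij_betw g B D"
  shows "bij_betw (map_sum f g) (A <+> B) (C <+> D)"
proof (rule bij_betw_imageI)
  show "inj_on (map_sum f g) (A <+> B)"
    using bij_betw_imp_inj_on[OF f] bij_betw_imp_inj_on[OF g]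
    by (auto intro!: inj_onI dest: inj_onD)
  have "map_sum f g ` (A <+> B) = f ` A <+> g ` B"
    by (simp add: Plus_def image_Un image_image)
  then show "map_sum f g ` (A <+> B) = C <+> D"
    using f g by (simp add: bij_betw_imp_surj_on)
qed

text \<open>Vertices and reversed edge sums are both numbered from \<open>0\<close>. If both numberings are stretched by
  the same factor \<open>a\<close>, an increase of the vertex sum of an edge is cancelled by the label of
  the edge, whatever the offsets \<open>b\<close> and \<open>d\<close> are. The offsets only have to make the two progressions
  tile the labels.\<close>

lemma edge_magic_labeling_affine:
  assumes G: "simple_graph G" and card: "card (verts G) = M" "card (edges G) = M"
    and l: "consecutive_edge_sums G l w"
    and tile: "bij_betw (case_sum (\<lambda>x. a * x + b) (\<lambda>y. a * y + d)) ({..<M} <+> {..<M}) {1..2 * M}"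
  shows "\<exists>f. edge_magic_labeling G f (a * (w + M - 1) + 2 * b + d)"
proof -
  let ?s = "\<lambda>e. \<Sum>u\<in>e. l u"
  \<comment> \<open>The edge with the largest sum gets rank \<open>0\<close>.\<close>
  let ?r = "\<lambda>e. w + M - 1 - ?s e"
  let ?f = "case_sum (\<lambda>x. a * x + b) (\<lambda>y. a * y + d) \<circ> map_sum l ?r"
  have lv: "bij_betw l (verts G) {..<M}" and le: "bij_betw ?s (edges G) {w..<w + M}"
    using l card by (simp_all add: consecutive_edge_sums_def)
  have "bij_betw (\<lambda>i. w + M - 1 - i) {w..<w + M} {..<M}"
    by (rule bij_betw_byWitness[where f' = "\<lambda>i. w + M - 1 - i"]) auto
  from bij_betw_trans[OF le this] have r: "bij_betw ?r (edges G) {..<M}"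
    by (simp add: comp_def)
  from bij_betw_trans[OF bij_betw_map_sum_Plus[OF lv r] tile] have "total_labeling G ?f"
    using card by (simp add: total_labeling_def mult_2)
  moreover have "edge_weight ?f e = a * (w + M - 1) + 2 * b + d" if e: "e \<in> edges G" for e
  proof -
    have "card e = 2"
      using G e by (auto simp: simple_graph_def)
    then have "(\<Sum>u\<in>e. a * l u + b) = a * ?s e + 2 * b"
      by (simp add: sum.distrib sum_distrib_left)
    moreover have "?s e + ?r e = w + M - 1"
      using bij_betwE[OF le] e by fastforce
    then have "a * ?s e + a * ?r e = a * (w + M - 1)"
      by (metis distrib_left)
    ultimately show ?thesis
      by (simp add: edge_weight_def)
  qed
  ultimately show ?thesis
    using edge_magic_labeling_iff[OF G] by blast
qed

lemma bij_betw_two_progressions: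
  assumes "inj_on F ({..<M} <+> {..<M})" and "F ` ({..<M} <+> {..<M}) \<subseteq> {1..2 * M}"
  shows "bij_betw F ({..<M} <+> {..<M}) {1..2 * (M::nat)}"
proof -
  have "card (F ` ({..<M} <+> {..<M})) = card {1..2 * M}"
    using assms(1) by (simp add: card_image card_Plus)
  then show ?thesis
    using assms card_subset_eq[OF _ assms(2)] by (simp add: bij_betw_def)
qed

text \<open>The four tilings are: vertices below or above the edges, and vertices on the odd or on the even
  labels.\<close>

lemma edge_magic_labelings_of_consecutive_edge_sums:
  assumes "simple_graph G" and "card (verts G) = M" "card (edges G) = M" and "M > 0"
    and "consecutive_edge_sums G l w"
    and "k \<in> {2 * M + w + 2, 3 * M + w + 2, 2 * M + 2 * w + 2, 2 * M + 2 * w + 3}"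
  shows "\<exists>f. edge_magic_labeling G f k"
proof -
  note label = edge_magic_labeling_affine[OF assms(1-3,5) bij_betw_two_progressions]
  from assms(6) consider "k = 2 * M + w + 2" | "k = 3 * M + w + 2"
    | "k = 2 * M + 2 * w + 2" | "k = 2 * M + 2 * w + 3"
    by auto
  then show ?thesis
  proof cases
    case 1
    have k: "k = 1 * (w + M - 1) + 2 * 1 + (M + 1)"
      using 1 \<open>M > 0\<close> by simp
    show ?thesis
      unfolding k by (rule label) (auto simp: inj_on_def)
  next
    case 2
    have k: "k = 1 * (w + M - 1) + 2 * (M + 1) + 1"
      using 2 \<open>M > 0\<close> by simp
    show ?thesis
      unfolding k by (rule label) (auto simp: inj_on_def)
  next
    case 3
    have k: "k = 2 * (w + M - 1) + 2 * 1 + 2"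
      using 3 \<open>M > 0\<close> by simp
    show ?thesis
      unfolding k by (rule label) (auto simp: inj_on_def Suc_double_not_eq_double double_not_eq_Suc_double)
  next
    case 4
    have k: "k = 2 * (w + M - 1) + 2 * 2 + 1"
      using 4 \<open>M > 0\<close> by simp
    show ?thesis
      unfolding k by (rule label) (auto simp: inj_on_def Suc_double_not_eq_double double_not_eq_Suc_double)
  qed
qed

section \<open>Crowns\<close>

lemma Suc_mod_less: "i < m \<Longrightarrow> Suc i mod m = (if Suc i = m then 0 else Suc i)"
  by auto

lemma bij_betw_Suc_mod:
  assumes "m > 0"
  shows "bij_betw (\<lambda>i. Suc i mod m) {..<m} {..<m}"
proof -
  have "inj_on (\<lambda>i. Suc i mod m) {..<m}"
    by (auto simp: inj_on_def Suc_mod_less split: if_splits)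
  moreover have "(\<lambda>i. Suc i mod m) ` {..<m} \<subseteq> {..<m}"
    using assms by auto
  ultimately show ?thesis
    by (simp add: bij_betw_def endo_inj_surj)
qed

abbreviation crown :: "nat \<Rightarrow> nat \<Rightarrow> (nat + nat \<times> nat) ugraph" where
  "crown m n \<equiv> cycle_graph m \<odot> edgeless_graph n"

lemma simple_graph_crown: "3 \<le> m \<Longrightarrow> simple_graph (crown m n)"
  by (intro simple_graph_corona simple_graph_cycle simple_graph_edgeless)

lemma verts_crown: "verts (crown m n) = {..<m} <+> {..<m} \<times> {..<n}"
  by (simp add: corona_def cycle_graph_def edgeless_graph_def)

lemma edges_crown:
  "edges (crown m n) = (\<lambda>i. {Inl i, Inl (Suc i mod m)}) ` {..<m}
     \<union> (\<lambda>(v, x). {Inl v, Inr (v, x)}) ` ({..<m} \<times> {..<n})"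
  by (simp add: corona_def cycle_graph_def edgeless_graph_def image_image)

lemma sum_edges_crown:
  fixes F :: "(nat + nat \<times> nat) set \<Rightarrow> 'b::comm_monoid_add"
  assumes "3 \<le> m"
  shows "(\<Sum>e\<in>edges (crown m n). F e) =
    (\<Sum>i<m. F {Inl i, Inl (Suc i mod m)}) + (\<Sum>(v, x)\<in>{..<m} \<times> {..<n}. F {Inl v, Inr (v, x)})"
proof -
  let ?c = "\<lambda>i. {Inl i, Inl (Suc i mod m)} :: (nat + nat \<times> nat) set"
  let ?p = "\<lambda>(v, x). {Inl v, Inr (v, x)} :: (nat + nat \<times> nat) set"
  have c: "inj_on ?c {..<m}"
    using assms by (auto simp: inj_on_def doubleton_eq_iff Suc_mod_less split: if_splits)
  have p: "inj_on ?p ({..<m} \<times> {..<n})"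
    by (auto simp: inj_on_def doubleton_eq_iff)
  have "(\<Sum>e\<in>edges (crown m n). F e) = (\<Sum>e\<in>?c ` {..<m}. F e) + (\<Sum>e\<in>?p ` ({..<m} \<times> {..<n}). F e)"
    unfolding edges_crown by (rule sum.union_disjoint) (auto simp: doubleton_eq_iff)
  moreover have "(\<Sum>e\<in>?p ` ({..<m} \<times> {..<n}). F e) =
      (\<Sum>(v, x)\<in>{..<m} \<times> {..<n}. F {Inl v, Inr (v, x)})"
    by (subst sum.reindex[OF p]) (simp add: comp_def case_prod_unfold)
  ultimately show ?thesis
    by (simp add: sum.reindex[OF c])
qed

lemma finite_crown: "finite (verts (crown m n))" "finite (edges (crown m n))"
  by (simp_all add: verts_crown edges_crown)

lemma card_verts_crown: "card (verts (crown m n)) = m * (n + 1)"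
  by (simp add: verts_crown card_Plus)

lemma card_edges_crown: "3 \<le> m \<Longrightarrow> card (edges (crown m n)) = m * (n + 1)"
  using sum_edges_crown[of m "\<lambda>_. 1 :: nat" n] by (simp add: case_prod_unfold)

lemma total_labeling_crown:
  assumes "3 \<le> m" and "M = m * (n + 1)"
  shows "total_labeling (crown m n) g \<longleftrightarrow>
    bij_betw g (verts (crown m n) <+> edges (crown m n)) {1..2 * M}"
  by (simp only: total_labeling_def card_verts_crown card_edges_crown[OF assms(1)] assms(2) mult_2)

section \<open>The extreme averages of a crown\<close>

text \<open>The largest of \<open>k\<close> distinct positive integers is at least \<open>k\<close>; removing it gives an induction.\<close>

lemma sum_distinct_positive_ge:
  fixes A :: "nat set"
  assumes "finite A" and "0 \<notin> A"
  shows "card A * (card A + 1) \<le> 2 * \<Sum>A"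
  using assms
proof (induction "card A" arbitrary: A)
  case 0
  then show ?case by simp
next
  case (Suc k)
  let ?M = "Max A"
  have ne: "A \<noteq> {}" using Suc by auto
  then have M: "?M \<in> A" using Suc by simp
  have "A \<subseteq> {1..?M}"
    using Suc.prems by (auto simp: Suc_le_eq intro: gr0I)
  then have "card A \<le> ?M"
    using card_mono[of "{1..?M}" A] by simp
  moreover have "card (A - {?M}) = k"
    using Suc M by simp
  moreover from this have "k * (k + 1) \<le> 2 * \<Sum>(A - {?M})"
    using Suc.hyps(1)[of "A - {?M}"] Suc.prems by simp
  moreover have "\<Sum>A = ?M + \<Sum>(A - {?M})"
    using M Suc.prems by (simp add: sum.remove)
  moreover have "card A = k + 1"
    using Suc.hyps(2) by simp
  ultimately show ?case
    by (simp add: algebra_simps)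
qed

text \<open>The reflection \<open>x \<mapsto> K + 1 - x\<close> reduces the upper bound to the lower one.\<close>

lemma sum_distinct_bounded_le:
  fixes A :: "nat set"
  assumes "A \<subseteq> {1..K}"
  shows "2 * \<Sum>A + card A * (card A + 1) \<le> 2 * (card A * (K + 1))"
proof -
  let ?B = "(\<lambda>x. K + 1 - x) ` A"
  have fin: "finite A" using assms finite_subset by blast
  have inj: "inj_on (\<lambda>x. K + 1 - x) A"
    using assms by (intro inj_onI) (auto simp: subset_iff)
  have "card ?B * (card ?B + 1) \<le> 2 * \<Sum>?B"
    by (rule sum_distinct_positive_ge) (use fin assms in auto)
  moreover have "\<Sum>?B + \<Sum>A = card A * (K + 1)"
  proof -
    have "\<Sum>?B + \<Sum>A = (\<Sum>x\<in>A. (K + 1 - x) + x)"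
      unfolding sum.reindex[OF inj] by (simp add: sum.distrib)
    also have "\<dots> = (\<Sum>x\<in>A. K + 1)"
      using assms by (intro sum.cong) auto
    finally show ?thesis by simp
  qed
  ultimately show ?thesis
    using inj by (simp add: card_image)
qed

text \<open>Among the \<open>n + 2\<close> edges at a cycle vertex, one accounts for its term in the sum of all labels and
  \<open>n + 1\<close> are surplus.\<close>

lemma sum_edge_weights_crown:
  assumes m: "3 \<le> m" and g: "total_labeling (crown m n) g" and M: "M = m * (n + 1)"
  shows "(\<Sum>e\<in>edges (crown m n). edge_weight g e) =
    (n + 1) * (\<Sum>i<m. g (Inl (Inl i))) + M * (2 * M + 1)"
proof -
  let ?V = "verts (crown m n)" and ?E = "edges (crown m n)"
  let ?h = "\<lambda>i. g (Inl (Inl i))" and ?l = "\<lambda>p. g (Inl (Inr p))"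
  have "(\<Sum>i<m. ?h (Suc i mod m)) = (\<Sum>i<m. ?h i)"
    using m sum.reindex_bij_betw[OF bij_betw_Suc_mod, of m ?h] by simp
  moreover have "i \<noteq> Suc i mod m" if "i < m" for i
    using m that by (simp add: Suc_mod_less)
  moreover have "(\<Sum>(v, x)\<in>{..<m} \<times> {..<n}. ?h v + ?l (v, x)) =
      n * (\<Sum>i<m. ?h i) + (\<Sum>p\<in>{..<m} \<times> {..<n}. ?l p)"
  proof -
    have "(\<Sum>(v, x)\<in>{..<m} \<times> {..<n}. ?h v) = (\<Sum>v<m. \<Sum>x<n. ?h v)"
      by (rule sum.cartesian_product[symmetric])
    then show ?thesis
      by (simp add: sum.distrib case_prod_unfold sum_distrib_left)
  qed
  ultimately have "(\<Sum>e\<in>?E. \<Sum>u\<in>e. g (Inl u)) =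
      2 * (\<Sum>i<m. ?h i) + (n * (\<Sum>i<m. ?h i) + (\<Sum>p\<in>{..<m} \<times> {..<n}. ?l p))"
    unfolding sum_edges_crown[OF m]
    by (simp add: sum.distrib)
  moreover have "(\<Sum>u\<in>?V. g (Inl u)) = (\<Sum>i<m. ?h i) + (\<Sum>p\<in>{..<m} \<times> {..<n}. ?l p)"
    unfolding verts_crown by (simp add: sum.Plus comp_def)
  ultimately have "(\<Sum>e\<in>?E. \<Sum>u\<in>e. g (Inl u)) = (n + 1) * (\<Sum>i<m. ?h i) + (\<Sum>u\<in>?V. g (Inl u))"
    by simp
  moreover have "(\<Sum>u\<in>?V. g (Inl u)) + (\<Sum>e\<in>?E. g (Inr e)) = M * (2 * M + 1)"
  proof -
    have "bij_betw g (?V <+> ?E) {1..2 * M}"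
      using g total_labeling_crown[OF m M] by blast
    then have "(\<Sum>z\<in>?V <+> ?E. g z) = \<Sum>{1..2 * M}"
      by (rule sum.reindex_bij_betw)
    also have "\<dots> = M * (2 * M + 1)"
      using double_gauss_sum_from_Suc_0[of "2 * M", where 'a = nat] by simp
    finally show ?thesis
      by (simp add: sum.Plus finite_crown comp_def)
  qed
  ultimately show ?thesis
    by (simp add: edge_weight_def sum.distrib)
qed

lemma sum_edge_weights_crown_bounds:
  assumes m: "m = 2 * h + 1" "3 \<le> m" and g: "total_labeling (crown m n) g"
    and M: "M = m * (n + 1)"
  shows "(\<Sum>e\<in>edges (crown m n). edge_weight g e) \<in> {(2 * M + h + 2) * M..(4 * M + 1 - h) * M}"
proof -
  let ?S = "\<Sum>i<m. g (Inl (Inl i))"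
  let ?A = "(\<lambda>i. g (Inl (Inl i))) ` {..<m}"
  have bij: "bij_betw g (verts (crown m n) <+> edges (crown m n)) {1..2 * M}"
    using g total_labeling_crown[OF m(2) M] by blast
  have dom: "Inl (Inl i) \<in> verts (crown m n) <+> edges (crown m n)" if "i < m" for i
    using that by (auto simp: verts_crown)
  have inj: "inj_on (\<lambda>i. g (Inl (Inl i))) {..<m}"
    using bij_betw_imp_inj_on[OF bij] dom by (auto intro!: inj_onI dest: inj_onD)
  have A: "?A \<subseteq> {1..2 * M}"
    using bij_betwE[OF bij] dom by blast
  have card: "card ?A = m" and sum: "\<Sum>?A = ?S"
    using inj by (simp_all add: card_image sum.reindex)
  have "m * (m + 1) \<le> 2 * ?S"
    using sum_distinct_positive_ge[of ?A] A unfolding card sum by fastforce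
  then have lower: "m * (h + 1) \<le> ?S"
    using m by simp
  have "2 * ?S + m * (m + 1) \<le> 2 * (m * (2 * M + 1))"
    using sum_distinct_bounded_le[OF A] unfolding card sum .
  then have upper: "?S + m * h \<le> m * (2 * M)"
    using m by (simp add: algebra_simps)
  have "h \<le> M" unfolding M m by simp
  then have e: "(4 * M + 1 - h) * M + M * h = M * (4 * M + 1)"
    by (simp flip: distrib_left add: mult.commute[of _ M])
  have "(2 * M + h + 2) * M = (n + 1) * (m * (h + 1)) + M * (2 * M + 1)"
    unfolding M by (simp add: algebra_simps)
  also have "\<dots> \<le> (n + 1) * ?S + M * (2 * M + 1)"
    by (intro add_right_mono mult_le_mono2 lower)
  finally have 1: "(2 * M + h + 2) * M \<le> (n + 1) * ?S + M * (2 * M + 1)" .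
  have "(n + 1) * ?S + M * (2 * M + 1) + M * h = (n + 1) * (?S + m * h) + M * (2 * M + 1)"
    unfolding M by (simp add: algebra_simps)
  also have "\<dots> \<le> (n + 1) * (m * (2 * M)) + M * (2 * M + 1)"
    by (intro add_right_mono mult_le_mono2 upper)
  also have "\<dots> = M * (4 * M + 1)"
    unfolding M by (simp add: algebra_simps)
  finally have 2: "(n + 1) * ?S + M * (2 * M + 1) \<le> (4 * M + 1 - h) * M"
    using e by linarith
  show ?thesis
    unfolding sum_edge_weights_crown[OF m(2) g M] using 1 2 by simp
qed

section \<open>Crowns with consecutive edge sums\<close>

text \<open>For odd \<open>m\<close>, this lists the residues modulo \<open>m\<close> in steps of \<open>(m + 1) / 2\<close>, the inverse of \<open>2\<close>,
  starting at \<open>(m - 1) / 2\<close>: the order is \<open>h, 0, h + 1, 1, \<dots>, 2 * h\<close> with \<open>h = m div 2\<close>.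
  Neighbouring sums then grow by exactly one along the cycle.\<close>

definition cycle_class :: "nat \<Rightarrow> nat \<Rightarrow> nat" where
  "cycle_class m j = (if odd j then j div 2 else j div 2 + m div 2)"

text \<open>For \<open>j < m\<close> this is \<open>(S - j) / m\<close> rounded up, that is, the least \<open>s\<close> with \<open>S \<le> j + m * s\<close>.\<close>

definition hub_level :: "nat \<Rightarrow> nat \<Rightarrow> nat \<Rightarrow> nat" where
  "hub_level m S j = (S + (m - 1 - j)) div m"

text \<open>The increasing enumeration of all numbers except \<open>s\<close>; it gives the levels that the cycle vertex of a
  class leaves to the pendant vertices.\<close>

definition skip :: "nat \<Rightarrow> nat \<Rightarrow> nat" where
  "skip s x = (if x < s then x else Suc x)"

text \<open>The pendant vertices at \<open>j\<close> belong to the residue class of the successor of \<open>j\<close>, not to that of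
  \<open>j\<close>. In this way the sums of the pendant edges at \<open>j\<close> and of the cycle edge leaving \<open>j\<close> agree
  modulo \<open>m\<close> and fill one progression.\<close>

definition crown_label :: "nat \<Rightarrow> nat \<Rightarrow> nat + nat \<times> nat \<Rightarrow> nat" where
  "crown_label m S u = (case u of
     Inl j \<Rightarrow> cycle_class m j + m * hub_level m S j
   | Inr (j, x) \<Rightarrow> cycle_class m (Suc j mod m) + m * skip (hub_level m S (Suc j mod m)) x)"

lemma cycle_class_add:
  assumes "odd m" and "j < m"
  shows "cycle_class m j + cycle_class m (Suc j mod m) = j + m div 2"
  using assms by (auto simp: cycle_class_def Suc_mod_less Suc_double_not_eq_double
      elim!: oddE evenE)

lemma cycle_class_surj:
  assumes "odd m" and "c < m"
  shows "\<exists>j<m. cycle_class m j = c"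
proof (cases "c < m div 2")
  case True
  then show ?thesis
    using assms by (intro exI[of _ "2 * c + 1"]) (auto simp: cycle_class_def elim!: oddE)
next
  case False
  then show ?thesis
    using assms by (intro exI[of _ "2 * (c - m div 2)"]) (auto simp: cycle_class_def elim!: oddE)
qed

text \<open>The numbers \<open>j + m * hub_level m S j\<close> are the representatives of the residues modulo \<open>m\<close> in the
  window \<open>{S..<S + m}\<close>.\<close>

lemma hub_level_bounds:
  assumes "j < m"
  shows "S \<le> j + m * hub_level m S j" and "j + m * hub_level m S j < S + m"
proof -
  define a where "a = S + (m - 1 - j)"
  have "a = m * hub_level m S j + a mod m" "a mod m < m"
    using assms by (simp_all add: hub_level_def a_def)
  then show "S \<le> j + m * hub_level m S j" and "j + m * hub_level m S j < S + m"
    using assms unfolding a_def by linarith+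
qed

lemma hub_level_le:
  assumes "S \<le> m * n" and "j < m"
  shows "hub_level m S j \<le> n"
proof -
  have "S + (m - 1 - j) < m * Suc n"
    using assms by simp
  then have "hub_level m S j < Suc n"
    unfolding hub_level_def by (metis less_mult_imp_div_less mult.commute)
  then show ?thesis by simp
qed

lemma skip_surj:
  assumes "t \<le> n" and "s \<le> n" and "t \<noteq> s"
  shows "\<exists>x<n. skip s x = t"
  using assms
  by (intro exI[of _ "if t < s then t else t - 1"]) (auto simp: skip_def)

lemma bij_betw_if_covers:
  assumes "finite A" and "card A = card B" and "B \<subseteq> f ` A"
  shows "bij_betw f A B"
proof -
  have "card (f ` A) \<le> card B"
    using assms card_image_le by metis
  then have "B = f ` A"
    using assms card_seteq by blast
  then show ?thesis
    using assms by (simp add: bij_betw_def eq_card_imp_inj_on)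
qed

text \<open>The out-neighbours of \<open>j\<close> (the next cycle vertex and the pendant vertices at \<open>j\<close>) carry all
  labels of one residue class.\<close>

lemma crown_label_class_surj:
  assumes "S \<le> m * n" and "j < m" and "t \<le> n"
  shows "\<exists>u\<in>insert (Inl (Suc j mod m)) (Inr ` ({j} \<times> {..<n})).
    crown_label m S u = cycle_class m (Suc j mod m) + m * t"
proof (cases "t = hub_level m S (Suc j mod m)")
  case True
  then show ?thesis by (simp add: crown_label_def)
next
  case False
  have "hub_level m S (Suc j mod m) \<le> n"
    using assms by (intro hub_level_le) auto
  then obtain x where "x < n" "skip (hub_level m S (Suc j mod m)) x = t"
    using skip_surj False assms by blast
  then show ?thesis
    by (intro bexI[of _ "Inr (j, x)"]) (auto simp: crown_label_def)
qed

text \<open>Since there are as many vertices and edges as numbers to be hit, only surjectivity is at stake.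
  For edge sums, \<open>y = z - m div 2\<close> determines the tail \<open>j = y mod m\<close> of the edge with sum \<open>z\<close>.
  The window property of \<open>hub_level\<close> says that the level still needed at the other end,
  \<open>y div m - hub_level m S j\<close>, is between \<open>0\<close> and \<open>n\<close>.\<close>

lemma consecutive_edge_sums_crown:
  assumes m: "odd m" "3 \<le> m" and S: "S \<le> m * n"
  shows "consecutive_edge_sums (crown m n) (crown_label m S) (S + m div 2)"
proof -
  let ?V = "verts (crown m n)" and ?E = "edges (crown m n)"
  let ?l = "crown_label m S" and ?M = "m * (n + 1)"
  let ?next = "\<lambda>j. Suc j mod m"
  have V: "insert (Inl (?next j)) (Inr ` ({j} \<times> {..<n})) \<subseteq> ?V" if "j < m" for j
    using that by (auto simp: verts_crown)
  have "z \<in> ?l ` ?V" if z: "z < ?M" for z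
  proof -
    obtain j where j: "j < m" "cycle_class m j = z mod m"
      using cycle_class_surj[OF m(1), of "z mod m"] m by auto
    have "?next ` {..<m} = {..<m}"
      using m by (intro bij_betw_imp_surj_on bij_betw_Suc_mod) simp
    then obtain i where i: "i < m" "j = ?next i"
      using j(1) by blast
    have "z div m \<le> n"
      using z by (metis Suc_eq_plus1 less_Suc_eq_le less_mult_imp_div_less mult.commute)
    then obtain u where "u \<in> insert (Inl (?next i)) (Inr ` ({i} \<times> {..<n}))"
      and "?l u = cycle_class m (?next i) + m * (z div m)"
      using crown_label_class_surj[OF S i(1)] by blast
    then have "u \<in> ?V" "?l u = z"
      using V[OF i(1)] i j by auto
    then show ?thesis by blast
  qed
  then have "bij_betw ?l ?V {..<?M}"
    by (intro bij_betw_if_covers) (auto simp: finite_crown card_verts_crown)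
  moreover
  have "z \<in> (\<lambda>e. \<Sum>u\<in>e. ?l u) ` ?E" if z: "z \<in> {S + m div 2..<S + m div 2 + ?M}" for z
  proof -
    define y j q where "y = z - m div 2" and "j = y mod m" and "q = y div m"
    have y: "S \<le> y" "y < S + ?M" "z = y + m div 2" "y = j + m * q" and j: "j < m"
      using z m by (auto simp: y_def j_def q_def)
    have "m * hub_level m S j < m * (q + 1)" "m * q < m * (hub_level m S j + (n + 1))"
      using y hub_level_bounds[OF j, of S] by (simp_all add: algebra_simps)
    then have "hub_level m S j < q + 1" "q < hub_level m S j + (n + 1)"
      by (simp_all only: mult_less_cancel1)
    then have q: "hub_level m S j \<le> q" "q - hub_level m S j \<le> n"
      by auto
    then obtain u where u: "u \<in> insert (Inl (?next j)) (Inr ` ({j} \<times> {..<n}))"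
      and lu: "?l u = cycle_class m (?next j) + m * (q - hub_level m S j)"
      using crown_label_class_surj[OF S j] by blast
    have "Inl j \<noteq> u"
      using u j m by (auto simp: Suc_mod_less split: if_splits)
    then have "(\<Sum>v\<in>{Inl j, u}. ?l v) = ?l (Inl j) + ?l u"
      by simp
    also have "\<dots> = j + m div 2 + m * (hub_level m S j + (q - hub_level m S j))"
      using cycle_class_add[OF m(1) j] unfolding lu
      by (simp add: crown_label_def algebra_simps)
    also have "\<dots> = z"
      using q y by simp
    finally have "(\<Sum>v\<in>{Inl j, u}. ?l v) = z" .
    moreover have "{Inl j, u} \<in> ?E"
      using u j by (auto simp: edges_crown)
    ultimately show ?thesis by blast
  qed
  then have "bij_betw (\<lambda>e. \<Sum>u\<in>e. ?l u) ?E {S + m div 2..<S + m div 2 + ?M}"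
    using m by (intro bij_betw_if_covers) (auto simp: finite_crown card_edges_crown)
  ultimately show ?thesis
    using m by (simp add: consecutive_edge_sums_def card_verts_crown card_edges_crown)
qed

section \<open>Perfect edge-magic crowns\<close>

text \<open>With \<open>w = S + h\<close> and \<open>S \<le> m * n\<close>, the four families of valences cover
  \<open>{2 * M + h + 2..4 * M + 1 - h}\<close>: the first family is its lower part, the second its upper part,
  and the \<open>m - 1\<close> integers between them lie in the range of the two doubled families because
  \<open>m \<le> m * n\<close>.\<close>

theorem perfect_edge_magic_odd_crown:
  assumes m: "odd m" "3 \<le> m" and n: "n > 0"
  shows "perfect_edge_magic (crown m n)"
proof -
  obtain h where h: "m = 2 * h + 1"
    using m by (auto elim: oddE)
  define M where "M = m * (n + 1)"
  have mn: "M = m * n + m" "m \<le> m * n"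
    using n by (simp_all add: M_def)
  have G: "simple_graph (crown m n)" "card (verts (crown m n)) = M" "card (edges (crown m n)) = M"
    using m by (simp_all add: simple_graph_crown card_verts_crown card_edges_crown M_def)
  have "M > 0" using mn m by simp
  show ?thesis
  proof (rule perfect_edge_magicI[where a = "2 * M + h + 2" and b = "4 * M + 1 - h"])
    show "simple_graph (crown m n)" by (rule G)
    show "edges (crown m n) \<noteq> {}" using G(3) \<open>M > 0\<close> by auto
    show "2 * M + h + 2 \<le> 4 * M + 1 - h" using mn h m by linarith
  next
    fix g assume "total_labeling (crown m n) g"
    then show "(\<Sum>e\<in>edges (crown m n). edge_weight g e)
      \<in> {(2 * M + h + 2) * card (edges (crown m n))..(4 * M + 1 - h) * card (edges (crown m n))}"
      unfolding G(3) by (rule sum_edge_weights_crown_bounds[OF h m(2) _ M_def])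
  next
    fix k assume k: "k \<in> {2 * M + h + 2..4 * M + 1 - h}"
    have label: "\<exists>f. edge_magic_labeling (crown m n) f k"
      if "S \<le> m * n" and "k \<in> {2 * M + (S + h) + 2, 3 * M + (S + h) + 2,
        2 * M + 2 * (S + h) + 2, 2 * M + 2 * (S + h) + 3}" for S
    proof -
      have "consecutive_edge_sums (crown m n) (crown_label m S) (S + h)"
        using consecutive_edge_sums_crown[OF m that(1)] h by simp
      from edge_magic_labelings_of_consecutive_edge_sums[OF G \<open>M > 0\<close> this that(2)]
      show ?thesis .
    qed
    consider "k \<le> 2 * M + h + 2 + m * n" | "3 * M + h + 2 \<le> k"
      | "2 * M + h + 2 + m * n < k" "k < 3 * M + h + 2"
      by linarith
    then show "\<exists>f. edge_magic_labeling (crown m n) f k"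
    proof cases
      case 1
      then show ?thesis
        using k by (intro label[of "k - (2 * M + h + 2)"]) auto
    next
      case 2
      then show ?thesis
        using k mn h by (intro label[of "k - (3 * M + h + 2)"]) auto
    next
      case 3
      define y where "y = k - (2 * M + 2 * h + 2)"
      have y: "k = 2 * M + 2 * h + 2 + y" "y \<le> 2 * (m * n)"
        using 3 mn h unfolding y_def by linarith+
      then have "y div 2 \<le> m * n" "y = 2 * (y div 2) \<or> y = 2 * (y div 2) + 1"
        by linarith+
      then show ?thesis
        using y by (intro label[of "y div 2"]) auto
    qed
  qed
qed

theorem theorem3p2:
  fixes p q m n :: nat
  assumes "prime p" and "odd p"
    and "prime q" and "odd q"
    and "p \<noteq> q"
    and "m = p * q"
    and "n > 0"
  shows "perfect_edge_magic (cycle_graph m \<odot> edgeless_graph n)"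
proof (rule perfect_edge_magic_odd_crown)
  show "odd m" using assms by simp
  have "p \<ge> 2" "q \<ge> 2" using assms prime_ge_2_nat by auto
  then have "2 * 2 \<le> m" unfolding \<open>m = p * q\<close> by (rule mult_le_mono)
  then show "3 \<le> m" by simp
qed fact

end
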